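(* Let $n\ge 2$, let $\alpha_1$ be a positive even integer, $\alpha_2$ a positive integer, and $\alpha_3,\dots,\alpha_n$ integers such that $K=C(\alpha_1,\alpha_2,\dots,\alpha_n)$ is a two-bridge knot. Then by performing $\frac12\alpha_1$ $\Delta$-moves one can exchange (switch over/under at) a crossing in the twist region of $\alpha_2$ in the diagram $C(\alpha_1,\alpha_2,\dots,\alpha_n)$, which turns the knot into $C(\alpha_1,\alpha_2-2,\alpha_3,\dots,\alpha_n)$. Consequently $$d_G^{\Delta}\big(C(\alpha_1,\alpha_2,\alpha_3,\dots,\alpha_n),\,C(\alpha_1,\alpha_2-2,\alpha_3,\dots,\alpha_n)\big)\le\frac12\alpha_1.$$
   Context: Knots are in $S^3$ and considered up to ambient isotopy. $\Delta$-move: a local move on diagrams of oriented knots. In a disk the diagram consists of three arcs, each two of which cross exactly once, the three crossings being the vertices of a triangle, and with cyclic over/under information (each arc passes over one of the other two and under the remaining one). The move replaces this by the picture obtained by pushing one arc across the crossing of the other two, keeping for each pair of arcs which one is over. In terms of 3-string tangles it replaces the braid $\sigma_1\sigma_2^{-1}\sigma_1$ by $\sigma_2\sigma_1^{-1}\sigma_2$ (or the mirror image, or inverse, of this replacement); the orientations of the arcs are arbitrary. Any two knots are related by finitely many $\Delta$-moves (and isotopy). The $\Delta$-Gordian distance $d_G^{\Delta}(K,K')$ is the minimum number of $\Delta$-moves needed to deform a diagram of $K$ into a diagram of $K'$ (isotopies being free). Conway's normal form $C(\alpha_1,\dots,\alpha_n)$ for integers $\alpha_1,\dots,\alpha_n$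 (zero and negative entries allowed): take four horizontal strings numbered $1,2,3,4$ from top to bottom; join the left ends $1$–$2$ and $3$–$4$; going from left to right insert $|\alpha_1|$ half-twists on strings $2,3$, then $|\alpha_2|$ half-twists on strings $1,2$ (the twist region of $\alpha_2$), then $|\alpha_3|$ half-twists on strings $2,3$, and so on alternately; finally join the right ends $1$–$2$ and $3$–$4$ if $n$ is odd, and $2$–$3$ and $1$–$4$ if $n$ is even. For odd $i$ a right-handed half-twist is counted positive, for even $i$ a left-handed half-twist is counted positive (so the diagram is alternating if all $\alpha_i>0$). Equivalently $C(\alpha_1,\dots,\alpha_n)$ is the two-bridge knot or link with fraction $\alpha_1+\cfrac{1}{\alpha_2+\cfrac{1}{\ddots+\cfrac{1}{\alpha_n}}}$ (computed with $1/0=\infty$, $1/\infty=0$); for example $C(\alpha_1)$ is the torus knot or link $T(2,\alpha_1)$ and $C(2,2)$ is the figure-eight knot. *)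

theory Defs
  imports Main "HOL-Library.Extended_Nat"
begin

section \<open>Link diagrams\<close>

text \<open>
  Links in the 3-sphere are represented by their diagrams in the plane, an ambient isotopy being a
  finite sequence of planar isotopies and Reidemeister moves (Reidemeister's theorem).  A diagram
  in general position with respect to the horizontal direction is read from left to right as the
  list of its singular events.  Between two events one sees a number of strings, numbered
  \<open>1, 2, \<dots>\<close> from top to bottom.  The event \<open>(p, i)\<close> happens at the strings \<open>i\<close> and \<open>i + 1\<close>:

    \<^item> \<open>(Cup, i)\<close> creates two new strings \<open>i\<close>, \<open>i + 1\<close>, joined at their left ends;
    \<^item> \<open>(Cap, i)\<close> joins the right ends of the strings \<open>i\<close>, \<open>i + 1\<close>, which disappear;
    \<^item> \<open>(Cross s, i)\<close> is a half-twist on the strings \<open>i\<close>, \<open>i + 1\<close>.  The string descending from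
      position \<open>i\<close> to position \<open>i + 1\<close> is the over-string iff \<open>s\<close> holds.  So \<open>s = True\<close> is the
      right-handed half-twist (the positive crossing if both strings are oriented to the right)
      and \<open>s = False\<close> the left-handed one.

  Orientations are not recorded: the moves below are allowed for arbitrary orientations of the
  strings involved and transport an orientation of the diagram.
\<close>

datatype piece = Cup | Cap | Cross bool

type_synonym event = "piece \<times> nat"

fun ins :: "piece \<Rightarrow> nat" where
  "ins Cup = 0" | "ins Cap = 2" | "ins (Cross s) = 2"

fun outs :: "piece \<Rightarrow> nat" where
  "outs Cup = 2" | "outs Cap = 0" | "outs (Cross s) = 2"

text \<open>\<open>tangle m w n\<close>: the events \<open>w\<close> can take place on \<open>m\<close> strings and leave \<open>n\<close> strings.\<close>

fun tangle :: "nat \<Rightarrow> event list \<Rightarrow> nat \<Rightarrow> bool" where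
  "tangle m [] n \<longleftrightarrow> m = n"
| "tangle m ((p, i) # w) n \<longleftrightarrow>
     1 \<le> i \<and> i + ins p \<le> m + 1 \<and> tangle (m - ins p + outs p) w n"

definition diagram :: "event list \<Rightarrow> bool" where
  "diagram D \<longleftrightarrow> tangle 0 D 0"

subsection \<open>Knots among links\<close>

text \<open>
  The point \<open>(k, x)\<close> lies on string \<open>x\<close>, after the first \<open>k\<close> events of the diagram.
\<close>

definition diagram_points :: "event list \<Rightarrow> (nat \<times> nat) set" where
  "diagram_points D = {(k, x). k \<le> length D \<and> (\<exists>m. tangle 0 (take k D) m \<and> 1 \<le> x \<and> x \<le> m)}"

inductive arc :: "event list \<Rightarrow> nat \<times> nat \<Rightarrow> nat \<times> nat \<Rightarrow> bool" for D where
  above: "k < length D \<Longrightarrow> D ! k = (p, i) \<Longrightarrow> x < i \<Longrightarrow> arc D (k, x) (Suc k, x)"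
| below: "k < length D \<Longrightarrow> D ! k = (p, i) \<Longrightarrow> i \<le> x \<Longrightarrow> arc D (k, x + ins p) (Suc k, x + outs p)"
| cup: "k < length D \<Longrightarrow> D ! k = (Cup, i) \<Longrightarrow> arc D (Suc k, i) (Suc k, i + 1)"
| cap: "k < length D \<Longrightarrow> D ! k = (Cap, i) \<Longrightarrow> arc D (k, i) (k, i + 1)"
| cross_down: "k < length D \<Longrightarrow> D ! k = (Cross s, i) \<Longrightarrow> arc D (k, i) (Suc k, i + 1)"
| cross_up: "k < length D \<Longrightarrow> D ! k = (Cross s, i) \<Longrightarrow> arc D (k, i + 1) (Suc k, i)"

definition knot_diagram :: "event list \<Rightarrow> bool" where
  "knot_diagram D \<longleftrightarrow> diagram D \<and> diagram_points D \<noteq> {} \<and>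
     (\<forall>P \<in> diagram_points D. \<forall>Q \<in> diagram_points D. (\<lambda>A B. arc D A B \<or> arc D B A)\<^sup>*\<^sup>* P Q)"


section \<open>Isotopy\<close>

text \<open>
  The first five families generate planar isotopy: events at distinct strings may be interchanged,
  a zigzag may be straightened, and an arc with a horizontal extremum may be turned over or
  under another string.  In the move \<open>R3\<close> the three strings \<open>a, b, c\<close>, counted from the
  top at the left, cross pairwise; \<open>s, t, u\<close> tell whether \<open>a\<close> is over \<open>b\<close>, \<open>a\<close> over \<open>c\<close> and
  \<open>b\<close> over \<open>c\<close>, respectively.  The only information excluded is the cyclic one.
\<close>

inductive isotopy_rule :: "event list \<Rightarrow> event list \<Rightarrow> bool" where
  interchange: "i \<le> j \<Longrightarrow> isotopy_rule [(p, i), (q, j + outs p)] [(q, j + ins p), (p, i)]"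
| zigzag_down: "isotopy_rule [(Cup, i + 1), (Cap, i)] []"
| zigzag_up: "isotopy_rule [(Cup, i), (Cap, i + 1)] []"
| turn_cup: "isotopy_rule [(Cup, i), (Cross s, i + 1)] [(Cup, i + 1), (Cross (\<not> s), i)]"
| turn_cap: "isotopy_rule [(Cross s, i), (Cap, i + 1)] [(Cross (\<not> s), i + 1), (Cap, i)]"
| R1_cup: "isotopy_rule [(Cup, i), (Cross s, i)] [(Cup, i)]"
| R1_cap: "isotopy_rule [(Cross s, i), (Cap, i)] [(Cap, i)]"
| R2: "isotopy_rule [(Cross s, i), (Cross (\<not> s), i)] []"
| R3: "\<not> (s = u \<and> t \<noteq> s) \<Longrightarrow>
    isotopy_rule [(Cross s, i), (Cross t, i + 1), (Cross u, i)]
                 [(Cross u, i + 1), (Cross t, i), (Cross s, i + 1)]"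

definition local_move ::
  "(event list \<Rightarrow> event list \<Rightarrow> bool) \<Rightarrow> event list \<Rightarrow> event list \<Rightarrow> bool" where
  "local_move R D D' \<longleftrightarrow> diagram D \<and> diagram D' \<and>
     (\<exists>a u v b. (R u v \<or> R v u) \<and> D = a @ u @ b \<and> D' = a @ v @ b)"

definition isotopic :: "event list \<Rightarrow> event list \<Rightarrow> bool" where
  "isotopic = (local_move isotopy_rule)\<^sup>*\<^sup>*"

definition link_type :: "event list \<Rightarrow> event list set" where
  "link_type D = {D'. isotopic D D'}"


section \<open>Delta moves and the Delta-Gordian distance\<close>

text \<open>
  The triangle with cyclic over/under information, excluded in \<open>R3\<close>: with the braid generators
  \<open>\<sigma>\<^sub>1, \<sigma>\<^sub>2\<close> this replaces \<open>\<sigma>\<^sub>1 \<sigma>\<^sub>2\<^sup>-\<^sup>1 \<sigma>\<^sub>1\<close> by \<open>\<sigma>\<^sub>2 \<sigma>\<^sub>1\<^sup>-\<^sup>1 \<sigma>\<^sub>2\<close> or, for the other value of \<open>s\<close>, the mirror images.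
\<close>

inductive delta_rule :: "event list \<Rightarrow> event list \<Rightarrow> bool" where
  "delta_rule [(Cross s, i), (Cross (\<not> s), i + 1), (Cross s, i)]
              [(Cross s, i + 1), (Cross (\<not> s), i), (Cross s, i + 1)]"

text \<open>\<open>deforms k D D'\<close>: \<open>D\<close> is deformed into \<open>D'\<close> by isotopies and exactly \<open>k\<close> Delta moves.\<close>

inductive deforms :: "nat \<Rightarrow> event list \<Rightarrow> event list \<Rightarrow> bool" where
  refl: "deforms 0 D D"
| isotopy: "deforms k D E \<Longrightarrow> isotopic E F \<Longrightarrow> deforms k D F"
| delta: "deforms k D E \<Longrightarrow> local_move delta_rule E F \<Longrightarrow> deforms (Suc k) D F"

text \<open>The value is \<open>\<infinity>\<close> if there is no deformation.\<close>

definition delta_gordian_distance :: "event list set \<Rightarrow> event list set \<Rightarrow> enat" where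
  "delta_gordian_distance K K' = Inf {enat k | k. \<exists>D \<in> K. \<exists>D' \<in> K'. deforms k D D'}"


section \<open>Conway's normal form\<close>

definition half_twists :: "bool \<Rightarrow> nat \<Rightarrow> int \<Rightarrow> event list" where
  "half_twists s i a = replicate (nat \<bar>a\<bar>) (Cross (if 0 \<le> a then s else \<not> s), i)"

text \<open>\<open>twist_region r a\<close>: the half-twists contributed by the \<open>r\<close>-th entry \<open>a\<close>, where \<open>r \<ge> 1\<close>.\<close>

definition twist_region :: "nat \<Rightarrow> int \<Rightarrow> event list" where
  "twist_region r a = (if odd r then half_twists True 2 a else half_twists False 1 a)"

fun twist_regions :: "nat \<Rightarrow> int list \<Rightarrow> event list" where
  "twist_regions r [] = []"
| "twist_regions r (a # as) = twist_region r a @ twist_regions (Suc r) as"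

text \<open>
  When \<open>n\<close> is even, the strings 1 and 4 have become the strings 1 and 2 after joining 2 and 3.
\<close>

definition conway :: "int list \<Rightarrow> event list" where
  "conway as = [(Cup, 1), (Cup, 3)] @ twist_regions 1 as @
     (if odd (length as) then [(Cap, 3), (Cap, 1)] else [(Cap, 2), (Cap, 1)])"

text \<open>Positions, in \<open>conway as\<close>, of the crossings in the twist region of the \<open>r\<close>-th entry.\<close>

definition crossings_of_region :: "int list \<Rightarrow> nat \<Rightarrow> nat set" where
  "crossings_of_region as r =
     {2 + (\<Sum>a\<leftarrow>take (r - 1) as. nat \<bar>a\<bar>) ..< 2 + (\<Sum>a\<leftarrow>take r as. nat \<bar>a\<bar>)}"

fun exchange_event :: "event \<Rightarrow> event" where
  "exchange_event (Cross s, i) = (Cross (\<not> s), i)"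
| "exchange_event (Cup, i) = (Cup, i)"
| "exchange_event (Cap, i) = (Cap, i)"

definition exchange_crossing :: "nat \<Rightarrow> event list \<Rightarrow> event list" where
  "exchange_crossing c D = D[c := exchange_event (D ! c)]"

end

theory Submission
  imports Defs
begin

text \<open>
  Write \<open>a\<close>, \<open>b\<close> for the right-handed half-twists on the strings 1, 2 and on the strings 2, 3, write
  \<open>a'\<close>, \<open>b'\<close> for their inverses, and \<open>C\<close> for the two cups at the left of a Conway normal form.  With
  \<open>\<alpha>\<^sub>1 = 2m\<close> the diagram begins with \<open>C b\<^sup>2\<^sup>m a'\<^sup>k\<close> where \<open>k = \<alpha>\<^sub>2\<close>, and exchanging a crossing in the second
  region turns one \<open>a'\<close> into \<open>a\<close>.  By second Reidemeister moves this crossing may be assumed to be the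
  first one of its region, so everything reduces to replacing \<open>C b\<^sup>2\<^sup>m a'\<close> by \<open>C b\<^sup>2\<^sup>m a\<close> with \<open>m\<close> Delta
  moves, whatever stands to the right (lemma \<open>twist_exchange\<close>).

  This goes by induction on \<open>m\<close>, one Delta move being spent on each full twist.  For \<open>m = 0\<close> the crossing
  is a kink on the first cup, and either kink can be undone.  For the step,
  \<open>b b a' = b (b a' b) b'\<close>, and the Delta move \<open>b a' b \<rightarrow> a b' a\<close> gives \<open>(b a b') a b' = a' b a a b'\<close>.
  Now \<open>a'\<close> stands right after the remaining \<open>m - 1\<close> full twists, so that the induction hypothesis
  turns it into \<open>a\<close>; and \<open>a b a a b' = b a b a b' = b b a b b' = b b a\<close> by the braid relation.
\<close>

section \<open>Rewriting four-string braids behind two cups\<close>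

abbreviation crossings :: "nat \<Rightarrow> event set" where
  "crossings m \<equiv> range Cross \<times> {1..<m}"

lemma Cross_in_range [simp]: "Cross s \<in> range Cross"
  by (rule rangeI)

lemma tangle_braid_append:
  "set x \<subseteq> crossings m \<Longrightarrow> tangle m (x @ w) n \<longleftrightarrow> tangle m w n"
proof (induction x)
  case (Cons e x)
  moreover from Cons.prems obtain s i where "e = (Cross s, i)" "1 \<le> i" "i < m"
    by auto
  moreover from this have "m - 2 + 2 = m"
    by simp
  ultimately show ?case
    by (simp del: add_2_eq_Suc add_2_eq_Suc')
qed simp

abbreviation cups :: "event list" where
  "cups \<equiv> [(Cup, 1), (Cup, 3)]"

lemma diagram_cups:
  "set x \<subseteq> crossings 4 \<Longrightarrow> diagram (cups @ x @ w) \<longleftrightarrow> tangle 4 w 0"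
  using tangle_braid_append[of x 4 w 0] by (simp add: diagram_def eval_nat_numeral)

text \<open>
  Moves are only defined between diagrams.  Since crossings do not change the number of strings, this
  condition only concerns \<open>w\<close> and persists when one braid word is replaced by another.
\<close>

lemma local_move_braid:
  assumes "R u v \<or> R v u" and "set (x @ u @ v) \<subseteq> crossings 4" and "tangle 4 w 0"
  shows "local_move R (cups @ x @ u @ w) (cups @ x @ v @ w)"
proof -
  have "diagram (cups @ x @ u @ w)" "diagram (cups @ x @ v @ w)"
    using assms diagram_cups[of "x @ u" w] diagram_cups[of "x @ v" w] by simp_all
  then show ?thesis
    unfolding local_move_def using assms(1) by (metis append.assoc)
qed

lemma isotopic_trans [trans]: "isotopic D E \<Longrightarrow> isotopic E F \<Longrightarrow> isotopic D F"
  unfolding isotopic_def by (rule rtranclp_trans)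

lemma isotopic_sym: "isotopic D E \<Longrightarrow> isotopic E D"
proof -
  have "symp (local_move isotopy_rule)"
    unfolding local_move_def by (rule sympI) blast
  then show "isotopic D E \<Longrightarrow> isotopic E D"
    unfolding isotopic_def by (metis sympD symp_rtranclp)
qed

lemma isotopic_braid:
  assumes "isotopy_rule u v" and "set (x @ u @ v) \<subseteq> crossings 4" and "tangle 4 w 0"
  shows "isotopic (cups @ x @ u @ w) (cups @ x @ v @ w)"
  unfolding isotopic_def using assms by (intro r_into_rtranclp local_move_braid) auto

text \<open>The beginning of the second cup separates the kink from its own cup, and the two are interchanged.\<close>

lemma kink_on_cup:
  assumes "tangle 4 w 0"
  shows "isotopic (cups @ (Cross s, 1) # w) (cups @ w)"
proof -
  let ?k = "(Cross s, 1)" and ?C1 = "(Cup, 1)" and ?C3 = "(Cup, 3)"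
  have w: "tangle (Suc (Suc (Suc (Suc 0)))) w 0"
    using assms by (simp add: eval_nat_numeral)
  have slide: "isotopy_rule [?k, ?C3] [?C3, ?k]"
    using interchange[of 1 1 "Cross s" Cup] by (simp add: eval_nat_numeral)
  have "local_move isotopy_rule (cups @ ?k # w) ([?C1, ?k] @ ?C3 # w)"
    unfolding local_move_def
  proof (intro conjI exI)
    show "isotopy_rule [?C3, ?k] [?k, ?C3] \<or> isotopy_rule [?k, ?C3] [?C3, ?k]"
      using slide by simp
    show "cups @ ?k # w = [?C1] @ [?C3, ?k] @ w" "[?C1, ?k] @ ?C3 # w = [?C1] @ [?k, ?C3] @ w"
      by simp_all
  qed (use w in \<open>simp_all add: diagram_def eval_nat_numeral\<close>)
  moreover have "local_move isotopy_rule ([?C1, ?k] @ ?C3 # w) (cups @ w)"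
    unfolding local_move_def
  proof (intro conjI exI)
    show "isotopy_rule [?C1, ?k] [?C1] \<or> isotopy_rule [?C1] [?C1, ?k]"
      using R1_cup by simp
    show "[?C1, ?k] @ ?C3 # w = [] @ [?C1, ?k] @ ?C3 # w" "cups @ w = [] @ [?C1] @ ?C3 # w"
      by simp_all
  qed (use w in \<open>simp_all add: diagram_def eval_nat_numeral\<close>)
  ultimately show ?thesis
    unfolding isotopic_def by (meson converse_rtranclp_into_rtranclp r_into_rtranclp)
qed

section \<open>Exchanging a crossing next to full twists\<close>

lemmas [trans] = deforms.isotopy

lemma deforms_add: "deforms l E F \<Longrightarrow> deforms k D E \<Longrightarrow> deforms (k + l) D F"
  by (induction rule: deforms.induct) (auto intro: deforms.intros)

text \<open>
  The right end \<open>w\<close> is arbitrary because, in the induction step, it has to absorb the braid \<open>b a a b'\<close>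
  that the Delta move leaves behind the crossing.
\<close>

lemma twist_exchange:
  assumes "tangle 4 w 0"
  shows "deforms m (cups @ replicate (2 * m) (Cross True, 2) @ (Cross False, 1) # w)
                   (cups @ replicate (2 * m) (Cross True, 2) @ (Cross True, 1) # w)"
  using assms
proof (induction m arbitrary: w)
  case 0
  have "isotopic (cups @ (Cross False, 1) # w) (cups @ (Cross True, 1) # w)"
    using kink_on_cup isotopic_sym isotopic_trans 0 by meson
  then show ?case
    by (auto intro: deforms.intros)
next
  case (Suc m)
  define a a' b b' :: event where ab:
    "a = (Cross True, 1)" "a' = (Cross False, 1)" "b = (Cross True, 2)" "b' = (Cross False, 2)"
  define r where "r = replicate (2 * m) b"
  have r: "set r \<subseteq> crossings 4"
    by (auto simp: r_def ab)
  have step: "replicate (2 * Suc m) b = r @ [b, b]"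
    by (simp add: r_def replicate_app_Cons_same)
  have braid: "tangle 4 (x @ w) 0" if "set x \<subseteq> crossings 4" for x
    using tangle_braid_append[OF that] Suc.prems by simp
  have iso: "isotopic (cups @ r @ x @ u @ y @ w) (cups @ r @ x @ v @ y @ w)"
    if "isotopy_rule u v" "set (x @ u @ v @ y) \<subseteq> crossings 4" for x u v y
    using isotopic_braid[of u v "r @ x" "y @ w"] that r braid by simp
  have bb': "isotopy_rule [b, b'] []"
    using R2[of True 2] by (simp add: ab)
  have bab': "isotopy_rule [a', b, a] [b, a, b']" and bab: "isotopy_rule [a, b, a] [b, a, b]"
    using R3[of False True True 1] R3[of True True True 1] by (simp_all add: ab eval_nat_numeral)
  have Delta: "delta_rule [a, b', a] [b, a', b]"
    using delta_rule.intros[of True 1] by (simp add: ab eval_nat_numeral)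

  \<comment> \<open>The inserted pair \<open>b b'\<close> creates the triangle \<open>b a' b\<close>.\<close>
  have s1: "isotopic (cups @ r @ [b, b, a'] @ w) (cups @ r @ [b, b, a', b, b'] @ w)"
    using isotopic_sym[OF iso[of "[b, b']" "[]" "[b, b, a']" "[]"]] bb' by (simp add: ab)
  have s2: "local_move delta_rule (cups @ r @ [b, b, a', b, b'] @ w)
                                  (cups @ r @ [b, a, b', a, b'] @ w)"
    using local_move_braid[of delta_rule "[b, a', b]" "[a, b', a]" "r @ [b]" "b' # w"]
      Delta r braid[of "[b']"] by (simp add: ab)
  have s3: "isotopic (cups @ r @ [b, a, b', a, b'] @ w) (cups @ r @ [a', b, a, a, b'] @ w)"
    using isotopic_sym[OF iso[of "[a', b, a]" "[b, a, b']" "[]" "[a, b']"]] bab' by (simp add: ab)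
  have first: "deforms 1 (cups @ r @ [b, b, a'] @ w) (cups @ r @ [a', b, a, a, b'] @ w)"
    using deforms.isotopy[OF deforms.delta[OF deforms.isotopy[OF deforms.refl s1] s2] s3] by simp

  have "deforms m (cups @ r @ [a', b, a, a, b'] @ w) (cups @ r @ [a, b, a, a, b'] @ w)"
    using Suc.IH[of "[b, a, a, b'] @ w"] braid[of "[b, a, a, b']"] by (simp add: r_def ab)
  also have "isotopic \<dots> (cups @ r @ [b, a, b, a, b'] @ w)"
    using iso[of "[a, b, a]" "[b, a, b]" "[]" "[a, b']"] bab by (simp add: ab)
  also have "isotopic \<dots> (cups @ r @ [b, b, a, b, b'] @ w)"
    using iso[of "[a, b, a]" "[b, a, b]" "[b]" "[b']"] bab by (simp add: ab)
  also have "isotopic \<dots> (cups @ r @ [b, b, a] @ w)"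
    using iso[of "[b, b']" "[]" "[b, b, a]" "[]"] bb' by (simp add: ab)
  finally have "deforms m (cups @ r @ [a', b, a, a, b'] @ w) (cups @ r @ [b, b, a] @ w)" .
  from deforms_add[OF this first]
  have "deforms (Suc m) (cups @ r @ [b, b, a'] @ w) (cups @ r @ [b, b, a] @ w)"
    by simp
  then show ?case
    unfolding ab(1,2,3)[symmetric] step by simp
qed

text \<open>
  The exchanged crossing is inverse to its neighbours in the twist region: it cancels with the
  crossing on its left, and a cancelling pair in the opposite order is inserted instead.
\<close>

lemma move_exchanged_crossing:
  assumes "set x \<subseteq> crossings 4" and "i \<in> {1..<4}" and "tangle 4 w 0"
  shows "isotopic (cups @ x @ replicate k (Cross (\<not> s), i) @ (Cross s, i) # w)
                  (cups @ x @ (Cross s, i) # replicate k (Cross (\<not> s), i) @ w)"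
  using assms(3)
proof (induction k arbitrary: w)
  case 0
  then show ?case by (simp add: isotopic_def)
next
  case (Suc k)
  let ?e = "(Cross s, i)" and ?e' = "(Cross (\<not> s), i)"
  have w: "tangle 4 (?e' # w) 0"
    using tangle_braid_append[of "[?e']" 4 w 0] Suc.prems assms(2) by simp
  have xk: "set (x @ replicate k ?e') \<subseteq> crossings 4"
    using assms(1,2) by auto
  have "isotopic (cups @ (x @ replicate k ?e') @ [?e', ?e] @ w) (cups @ (x @ replicate k ?e') @ [] @ w)"
    using R2[of "\<not> s" i] Suc.prems xk assms(2) by (intro isotopic_braid) auto
  also have "isotopic \<dots> (cups @ (x @ replicate k ?e') @ [?e, ?e'] @ w)"
    using R2[of s i] Suc.prems xk assms(2) by (intro isotopic_sym[OF isotopic_braid]) auto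
  also have "isotopic \<dots> (cups @ x @ ?e # replicate k ?e' @ ?e' # w)"
    using Suc.IH[OF w] by simp
  finally show ?case
    by (simp add: replicate_app_Cons_same)
qed

theorem claim2p3:
  fixes \<alpha>1 \<alpha>2 :: int and \<alpha>s :: "int list"
  assumes "0 < \<alpha>1" and "even \<alpha>1" and "0 < \<alpha>2"
    and "knot_diagram (conway (\<alpha>1 # \<alpha>2 # \<alpha>s))"
  shows "(\<forall>c \<in> crossings_of_region (\<alpha>1 # \<alpha>2 # \<alpha>s) 2.
            deforms (nat (\<alpha>1 div 2)) (conway (\<alpha>1 # \<alpha>2 # \<alpha>s))
              (exchange_crossing c (conway (\<alpha>1 # \<alpha>2 # \<alpha>s))) \<and>
            isotopic (exchange_crossing c (conway (\<alpha>1 # \<alpha>2 # \<alpha>s)))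
              (conway (\<alpha>1 # (\<alpha>2 - 2) # \<alpha>s))) \<and>
         delta_gordian_distance
            (link_type (conway (\<alpha>1 # \<alpha>2 # \<alpha>s)))
            (link_type (conway (\<alpha>1 # (\<alpha>2 - 2) # \<alpha>s)))
          \<le> enat (nat (\<alpha>1 div 2))"
proof -
  define m where "m = nat (\<alpha>1 div 2)"
  define n where "n = nat \<alpha>2"
  define w where "w = twist_regions 3 \<alpha>s @
    (if odd (length \<alpha>s) then [(Cap, 3), (Cap, 1)] else [(Cap, 2), (Cap, 1)])"
  define x where "x = replicate (2 * m) (Cross True, 2 :: nat)"
  let ?e = "(Cross True, 1)" and ?e' = "(Cross False, 1)"
  let ?D = "conway (\<alpha>1 # \<alpha>2 # \<alpha>s)" and ?D' = "conway (\<alpha>1 # (\<alpha>2 - 2) # \<alpha>s)"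
  have m: "nat \<bar>\<alpha>1\<bar> = 2 * m"
    using assms(1,2) by (auto simp: m_def)
  have n: "n > 0" "nat \<bar>\<alpha>2\<bar> = n"
    using assms(3) by (auto simp: n_def)
  have conway: "conway (\<alpha>1 # \<beta> # \<alpha>s) = cups @ x @ half_twists False 1 \<beta> @ w" for \<beta>
    using assms(1) m even_Suc_Suc_iff[of "length \<alpha>s"]
    by (simp add: conway_def twist_region_def half_twists_def x_def w_def numeral_3_eq_3)
  have D: "?D = cups @ x @ replicate n ?e' @ w"
    using assms(3) n by (simp add: conway half_twists_def)
  have x: "set x \<subseteq> crossings 4"
    by (auto simp: x_def)
  have braid: "set (replicate k ?e') \<subseteq> crossings 4" for k
    by auto
  have "tangle 4 w 0"
    using assms(4) diagram_cups[of "x @ replicate n ?e'" w] x braid[of n]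
    by (simp add: knot_diagram_def D)
  then have tangle: "tangle 4 (replicate k ?e' @ w) 0" for k
    using tangle_braid_append[OF braid] by blast

  \<comment> \<open>The common target: every exchange in the region gives \<open>E\<close> up to isotopy.\<close>
  define E where "E = cups @ x @ ?e # replicate (n - 1) ?e' @ w"
  have "deforms m (cups @ x @ ?e' # replicate (n - 1) ?e' @ w) E"
    unfolding E_def x_def by (rule twist_exchange[OF tangle])
  moreover have "?e' # replicate (n - 1) ?e' = replicate n ?e'"
    using n(1) by (cases n) auto
  ultimately have D_E: "deforms m ?D E"
    by (metis D append_Cons)

  have E_D': "isotopic E ?D'"
  proof (cases "n = 1")
    case True
    then have "\<alpha>2 = 1"
      using assms(3) by (simp add: n_def)
    then have "half_twists False 1 (\<alpha>2 - 2) = [?e]"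
      by (simp add: half_twists_def)
    then show ?thesis
      using True by (simp add: E_def conway isotopic_def)
  next
    case False
    then obtain k where k: "n = Suc (Suc k)"
      using n(1) by (metis One_nat_def not0_implies_Suc not_gr_zero)
    then have "half_twists False 1 (\<alpha>2 - 2) = replicate k ?e'"
      by (auto simp: n_def half_twists_def nat_eq_iff2)
    moreover have "isotopic (cups @ x @ [?e, ?e'] @ replicate k ?e' @ w)
                            (cups @ x @ [] @ replicate k ?e' @ w)"
      using R2[of True 1] x tangle by (intro isotopic_braid) auto
    ultimately show ?thesis
      using k by (simp add: E_def conway)
  qed

  have exchange: "isotopic (exchange_crossing c ?D) E"
    if c: "c \<in> crossings_of_region (\<alpha>1 # \<alpha>2 # \<alpha>s) 2" for c
  proof -
    obtain k where k: "c = length (cups @ x) + k" "k < n"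
      using c m n by (auto simp: crossings_of_region_def x_def dest!: le_Suc_ex)
    then obtain l where l: "n = k + Suc l"
      using less_iff_Suc_add by auto
    have split: "?D = (cups @ x @ replicate k ?e') @ ?e' # replicate l ?e' @ w"
      by (simp add: D l replicate_add replicate_app_Cons_same)
    have len: "c = length (cups @ x @ replicate k ?e')"
      using k by simp
    have "exchange_crossing c ?D = (cups @ x @ replicate k ?e') @ ?e # replicate l ?e' @ w"
      unfolding exchange_crossing_def split len by (simp only: nth_append_length list_update_length) simp
    moreover have "isotopic (cups @ x @ replicate k ?e' @ ?e # replicate l ?e' @ w)
                            (cups @ x @ ?e # replicate k ?e' @ replicate l ?e' @ w)"
      using move_exchanged_crossing[OF x, of 1 "replicate l ?e' @ w" k True] tangle by simp
    moreover have "replicate k ?e' @ replicate l ?e' = replicate (n - 1) ?e'"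
      using l by (simp add: replicate_add)
    ultimately show ?thesis
      unfolding E_def by (metis append.assoc)
  qed

  have "deforms m ?D ?D'"
    using D_E E_D' by (rule deforms.isotopy)
  moreover have "?D \<in> link_type ?D" "?D' \<in> link_type ?D'"
    by (simp_all add: link_type_def isotopic_def)
  ultimately have "delta_gordian_distance (link_type ?D) (link_type ?D') \<le> enat m"
    unfolding delta_gordian_distance_def by (intro Inf_lower) blast
  then show ?thesis
    using exchange D_E E_D' isotopic_sym isotopic_trans deforms.isotopy
    unfolding m_def by blast
qed

end
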